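(* Let $t\ge 2$ and let $\boldsymbol{R}$ be a symmetric cycle in the hypercube graph $\boldsymbol{H}(t,2)$, with vertex set $\mathfrak{V}(\boldsymbol{R})$. For each vertex $T\in\{1,-1\}^t$, let $\boldsymbol{Q}(T,\boldsymbol{R})\subset\mathfrak{V}(\boldsymbol{R})$ be the unique inclusion-minimal subset such that $T=\sum_{Q\in\boldsymbol{Q}(T,\boldsymbol{R})}Q$. Then for every odd integer $j$ with $1\le j\le t$, $$c_j(t):=\bigl|\bigl\{T\in\{1,-1\}^t:\ |\boldsymbol{Q}(T,\boldsymbol{R})|=j\bigr\}\bigr|=2\binom{t}{j}.$$ In other words, the polynomial $\boldsymbol{\gamma}_t(\mathrm{x}):=\sum_{1\le j\le t,\ j\text{ odd}}c_j(t)\,\mathrm{x}^j$ equals $2\sum_{1\le j\le t,\ j\text{ odd}}\binom{t}{j}\mathrm{x}^j$.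
   Context: The hypercube graph $\boldsymbol{H}(t,2)$ has vertex set $\{1,-1\}^t$, regarded as row vectors in $\mathbb{R}^t$; two vertices are adjacent iff they differ in exactly one component. A symmetric cycle in $\boldsymbol{H}(t,2)$ is a cycle $\boldsymbol{R}=(R^0,R^1,\ldots,R^{2t-1},R^0)$ of length $2t$ in this graph (with $2t$ distinct vertices) such that $R^{k+t}=-R^k$ for $0\le k\le t-1$. Its vertex set is $\mathfrak{V}(\boldsymbol{R})=\{R^0,\ldots,R^{2t-1}\}$. It is known that for every $T\in\{1,-1\}^t$ there is a unique inclusion-minimal subset $\boldsymbol{Q}(T,\boldsymbol{R})\subset\mathfrak{V}(\boldsymbol{R})$ whose elements sum (in $\mathbb{R}^t$) to $T$, and that its cardinality is odd. *)

theory Defs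
  imports "HOL-Analysis.Analysis" "HOL-Computational_Algebra.Polynomial"
begin

text \<open>
  The dimension \<open>t\<close> is the cardinality of the finite index type \<open>'t\<close>, so the vertices of
  \<open>H(t,2)\<close> are vectors of type \<open>real ^ 't\<close>.
\<close>

definition hypercube_verts :: "(real ^ 't) set" where
  "hypercube_verts = {T. \<forall>i. T $ i \<in> {1, -1}}"

definition hypercube_adj :: "real ^ 't \<Rightarrow> real ^ 't \<Rightarrow> bool" where
  "hypercube_adj X Y \<longleftrightarrow>
     X \<in> hypercube_verts \<and> Y \<in> hypercube_verts \<and> card {i. X $ i \<noteq> Y $ i} = 1"

text \<open>
  A cycle of length \<open>n\<close> is given by its vertices \<open>R 0, \<dots>, R (n - 1)\<close>, which are
  closed up by the edge from \<open>R (n - 1)\<close> to \<open>R 0\<close>; the values \<open>R k\<close> for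
  \<open>k \<ge> n\<close> are irrelevant.
\<close>

definition hypercube_cycle :: "nat \<Rightarrow> (nat \<Rightarrow> real ^ 't) \<Rightarrow> bool" where
  "hypercube_cycle n R \<longleftrightarrow>
     n \<ge> 3 \<and> inj_on R {..<n} \<and> (\<forall>k<n. hypercube_adj (R k) (R (Suc k mod n)))"

definition symmetric_cycle :: "(nat \<Rightarrow> real ^ 't) \<Rightarrow> bool" where
  "symmetric_cycle R \<longleftrightarrow>
     hypercube_cycle (2 * CARD('t)) R \<and> (\<forall>k<CARD('t). R (k + CARD('t)) = - R k)"

definition cycle_verts :: "(nat \<Rightarrow> real ^ 't) \<Rightarrow> (real ^ 't) set" where
  "cycle_verts R = R ` {..<2 * CARD('t)}"

definition minimal_decomposition :: "real ^ 't \<Rightarrow> (nat \<Rightarrow> real ^ 't) \<Rightarrow> (real ^ 't) set \<Rightarrow> bool" where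
  "minimal_decomposition T R S \<longleftrightarrow>
     S \<subseteq> cycle_verts R \<and> \<Sum>S = T \<and> (\<forall>S'. S' \<subset> S \<longrightarrow> \<Sum>S' \<noteq> T)"

definition Q_set :: "real ^ 't \<Rightarrow> (nat \<Rightarrow> real ^ 't) \<Rightarrow> (real ^ 't) set" where
  "Q_set T R = (THE S. minimal_decomposition T R S)"

definition c_num :: "(nat \<Rightarrow> real ^ 't) \<Rightarrow> nat \<Rightarrow> nat" where
  "c_num R j = card {T \<in> hypercube_verts. card (Q_set T R) = j}"

definition gamma_poly :: "(nat \<Rightarrow> real ^ 't) \<Rightarrow> int poly" where
  "gamma_poly R = (\<Sum>j | 1 \<le> j \<and> j \<le> CARD('t) \<and> odd j. monom (int (c_num R j)) j)"

end

theory Submission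
  imports Defs
begin

text \<open>
  A symmetric cycle flips every coordinate exactly once on its first half, so after reordering
  coordinates and adjusting signs its first half consists of the vectors
  \<open>(-1, \<dots>, -1, 1, \<dots>, 1)\<close>. These form a basis, and the coefficients of a vertex \<open>T\<close> in this
  basis are half the differences of cyclically consecutive signs of \<open>T\<close> (with a twist by \<open>-1\<close>
  when wrapping around), hence lie in \<open>{-1, 0, 1}\<close>. Consequently \<open>Q(T, R)\<close> is in bijection with
  the positions of the sign changes of \<open>T\<close>. Because of the twist the number of sign changes is odd, and
  every odd set of positions together with an initial sign arises from exactly one \<open>T\<close>.
\<close>

section \<open>Normal form of a symmetric cycle\<close>

lemma hypercube_verts_cases:
  assumes "T \<in> hypercube_verts"
  obtains "T $ i = 1" | "T $ i = -1"
  using assms unfolding hypercube_verts_def by blast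

text \<open>\<open>d k\<close> is the coordinate flipped between \<open>R k\<close> and
  \<open>R (Suc k)\<close>. Thus \<open>R 0\<close> and \<open>d\<close> determine the first half of
  the cycle, and antipodes give the second half.\<close>

locale flip_order =
  fixes R :: "nat \<Rightarrow> real ^ 't" and d :: "nat \<Rightarrow> 't"
  assumes bij_d: "bij_betw d {..<CARD('t)} UNIV"
    and R0: "R 0 \<in> hypercube_verts"
    and R_nth: "\<And>k m. k < CARD('t) \<Longrightarrow> m < CARD('t) \<Longrightarrow>
      R k $ d m = (if m < k then - (R 0 $ d m) else R 0 $ d m)"
    and inj_R: "inj_on R {..<2 * CARD('t)}"
    and R_antipode: "\<And>k. k < CARD('t) \<Longrightarrow> R (k + CARD('t)) = - R k"

text \<open>The path from \<open>R 0\<close> to its antipode has as many edges as there are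
  coordinates and must flip all of them, so it flips each exactly once.\<close>

lemma symmetric_cycle_flip_order:
  fixes R :: "nat \<Rightarrow> real ^ 't"
  assumes "symmetric_cycle R"
  obtains d where "flip_order R d"
proof -
  let ?t = "CARD('t)"
  have cyc: "hypercube_cycle (2 * ?t) R" and anti: "\<And>k. k < ?t \<Longrightarrow> R (k + ?t) = - R k"
    using assms unfolding symmetric_cycle_def by auto
  have inj: "inj_on R {..<2 * ?t}"
    using cyc unfolding hypercube_cycle_def by blast
  have adj: "hypercube_adj (R k) (R (Suc k))" if "k < ?t" for k
  proof -
    have "k < 2 * ?t"
      using that by simp
    then have "hypercube_adj (R k) (R (Suc k mod (2 * ?t)))"
      using cyc unfolding hypercube_cycle_def by blast
    moreover have "Suc k mod (2 * ?t) = Suc k"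
      using that by (intro mod_less) linarith
    ultimately show ?thesis by (simp only:)
  qed
  have vert: "R k \<in> hypercube_verts" if "k \<le> ?t" for k
    \<comment> \<open>The case where \<open>k\<close> equals the dimension is covered as the far end
      of the preceding edge.\<close>
    using adj[of k] adj[of "k - 1"] that unfolding hypercube_adj_def
    by (cases "k < ?t") (auto simp: le_less)
  have "\<exists>i. {i. R k $ i \<noteq> R (Suc k) $ i} = {i}" if "k < ?t" for k
    using adj[OF that] unfolding hypercube_adj_def by (auto simp: card_1_singleton_iff)
  then obtain d where d: "\<And>k. k < ?t \<Longrightarrow> {i. R k $ i \<noteq> R (Suc k) $ i} = {d k}"
    by metis
  have step: "R (Suc k) $ i = (if i = d k then - (R k $ i) else R k $ i)" if "k < ?t" for k i
  proof (cases "i = d k")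
    case True
    then have "R (Suc k) $ i \<noteq> R k $ i" using d[OF that] by force
    then show ?thesis
      using True vert[of k] vert[of "Suc k"] that
      by (auto elim!: hypercube_verts_cases[of _ i])
  next
    case False
    then show ?thesis using d[OF that] by force
  qed
  have surj: "i \<in> d ` {..<?t}" for i
  proof (rule ccontr)
    assume no: "i \<notin> d ` {..<?t}"
    \<comment> \<open>A coordinate that is never flipped would be the same in \<open>R 0\<close> and
      in \<open>- R 0\<close>.\<close>
    have "R k $ i = R 0 $ i" if "k \<le> ?t" for k
      using that
    proof (induction k)
      case (Suc k)
      then show ?case using step[of k i] no by auto
    qed simp
    from this[of ?t] anti[of 0] vert[of 0] show False
      by (auto elim!: hypercube_verts_cases[of _ i])
  qed
  have img: "d ` {..<?t} = UNIV" using surj by blast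
  then have inj_d: "inj_on d {..<?t}"
    by (intro eq_card_imp_inj_on) auto
  have "R k $ d m = (if m < k then - (R 0 $ d m) else R 0 $ d m)"
    if "k \<le> ?t" "m < ?t" for k m
    using that(1)
  proof (induction k)
    case (Suc k)
    have "d m = d k \<longleftrightarrow> m = k"
      using inj_d that(2) Suc.prems by (auto dest: inj_onD)
    then show ?case using Suc step[of k "d m"] by auto
  qed simp
  then have "flip_order R d"
    using img inj_d inj anti vert[of 0] by unfold_locales (auto simp: bij_betw_def)
  then show ?thesis by (rule that)
qed

section \<open>Signs relative to \<open>R 0\<close>\<close>

context flip_order
begin

text \<open>
  Index \<open>0\<close> is the twisted predecessor of index \<open>1\<close>: it carries the negated last sign.
\<close>

definition rel_sign :: "real ^ 't \<Rightarrow> nat \<Rightarrow> real" where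
  "rel_sign T k = (case k of
      0 \<Rightarrow> - (R 0 $ d (CARD('t) - 1) * T $ d (CARD('t) - 1))
    | Suc m \<Rightarrow> R 0 $ d m * T $ d m)"

definition coef :: "real ^ 't \<Rightarrow> nat \<Rightarrow> real" where
  "coef T k = (rel_sign T (Suc k) - rel_sign T k) / 2"

definition sign_changes :: "real ^ 't \<Rightarrow> nat set" where
  "sign_changes T = {k. k < CARD('t) \<and> rel_sign T (Suc k) \<noteq> rel_sign T k}"

text \<open>For odd \<open>card A\<close>, this is the vertex whose relative signs start from
  \<open>e\<close> at index \<open>0\<close> and change exactly at \<open>A\<close>. The inverse of
  \<open>d\<close> gives the position of \<open>i\<close>, and the factor \<open>R 0 $ i\<close>
  undoes the normalisation in \<open>rel_sign\<close>.\<close>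

definition signed_vertex :: "nat set \<times> real \<Rightarrow> real ^ 't" where
  "signed_vertex = (\<lambda>(A, e).
     \<chi> i. let m = the_inv_into {..<CARD('t)} d i in R 0 $ i * (e * (-1) ^ card (A \<inter> {..m})))"

lemma card_pos: "0 < CARD('t)"
  by simp

lemma R0_square [simp]: "R 0 $ i * R 0 $ i = 1"
  using R0 by (auto elim!: hypercube_verts_cases[of _ i])

lemma R0_mult_left [simp]: "R 0 $ i * (R 0 $ i * x) = x"
  by (simp add: mult.assoc[symmetric])

lemma rel_sign_Suc: "rel_sign T (Suc m) = R 0 $ d m * T $ d m"
  by (simp add: rel_sign_def)

lemma rel_sign_wrap: "rel_sign T CARD('t) = - rel_sign T 0"
  using card_pos by (cases "CARD('t)") (auto simp: rel_sign_def)

lemma rel_sign_cases: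
  assumes "T \<in> hypercube_verts"
  shows "rel_sign T k = 1 \<or> rel_sign T k = -1"
proof -
  have "R 0 $ i * T $ i = 1 \<or> R 0 $ i * T $ i = -1" for i
    by (rule hypercube_verts_cases[OF R0, of i]; rule hypercube_verts_cases[OF assms, of i]) auto
  then show ?thesis
    unfolding rel_sign_def by (cases k) (simp_all add: disj_commute eq_commute[of "-1"])
qed

lemma vec_eq_iff_d: "X = Y \<longleftrightarrow> (\<forall>m<CARD('t). X $ d m = Y $ d m)"
proof -
  have "(\<forall>i. X $ i = Y $ i) \<longleftrightarrow> (\<forall>i\<in>d ` {..<CARD('t)}. X $ i = Y $ i)"
    using bij_d by (simp add: bij_betw_def)
  then show ?thesis by (auto simp: vec_eq_iff)
qed

lemma vec_eq_iff_rel_sign: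
  "X = Y \<longleftrightarrow> (\<forall>m<CARD('t). rel_sign X (Suc m) = rel_sign Y (Suc m))"
  unfolding vec_eq_iff_d rel_sign_Suc by (metis R0_mult_left)

section \<open>Coordinates in the basis given by the first half of the cycle\<close>

text \<open>Relative to \<open>R 0\<close>, the entry of \<open>R k\<close> at position
  \<open>m\<close> is \<open>1\<close> for \<open>k\<close> up to \<open>m\<close> and
  \<open>-1\<close> afterwards; the value is therefore the head of the sum of \<open>x\<close> minus
  its tail.\<close>

lemma combination_rel_sign:
  assumes m: "m < CARD('t)"
  shows "rel_sign (\<Sum>k<CARD('t). x k *\<^sub>R R k) (Suc m) = 2 * (\<Sum>k\<le>m. x k) - (\<Sum>k<CARD('t). x k)"
proof -
  have "rel_sign (\<Sum>k<CARD('t). x k *\<^sub>R R k) (Suc m)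
      = (\<Sum>k<CARD('t). 2 * (if k \<in> {..m} then x k else 0) - x k)"
    unfolding rel_sign_Suc sum_component sum_distrib_left
  proof (intro sum.cong refl)
    fix k assume "k \<in> {..<CARD('t)}"
    then have "R k $ d m = R 0 $ d m * (if m < k then -1 else 1)"
      using R_nth[of k m] m by simp
    then show "R 0 $ d m * (x k *\<^sub>R R k) $ d m = 2 * (if k \<in> {..m} then x k else 0) - x k"
      by (simp add: mult.left_commute[of "x k"])
  qed
  also have "\<dots> = 2 * (\<Sum>k<CARD('t). if k \<in> {..m} then x k else 0) - (\<Sum>k<CARD('t). x k)"
    by (simp add: sum_subtractf sum_distrib_left)
  also have "(\<Sum>k<CARD('t). if k \<in> {..m} then x k else 0) = (\<Sum>k\<in>{..<CARD('t)} \<inter> {..m}. x k)"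
    by (subst sum.inter_restrict) auto
  also have "{..<CARD('t)} \<inter> {..m} = {..m}"
    using m by auto
  finally show ?thesis .
qed

text \<open>Consecutive relative signs of the combination differ by \<open>2 * x k\<close>, so the
  signs and the coefficients determine each other.\<close>

lemma combination_eq_iff:
  "(\<Sum>k<CARD('t). x k *\<^sub>R R k) = T \<longleftrightarrow> (\<forall>k<CARD('t). x k = coef T k)"
proof
  assume T: "(\<Sum>k<CARD('t). x k *\<^sub>R R k) = T"
  let ?X = "\<Sum>k<CARD('t). x k"
  have sg: "rel_sign T (Suc m) = 2 * (\<Sum>k\<le>m. x k) - ?X" if "m < CARD('t)" for m
    using combination_rel_sign[OF that, of x] unfolding T .
  obtain n where n: "CARD('t) = Suc n"
    using card_pos by (cases "CARD('t)") auto
  \<comment> \<open>At the last position the partial sum is all of \<open>?X\<close>. The twist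
    negates it, which matches the formula \<open>sg\<close> with an empty partial sum, so
    differencing also works at index \<open>0\<close>.\<close>
  have "rel_sign T 0 = - ?X"
    using rel_sign_wrap[of T] sg[of n] by (simp add: n lessThan_Suc_atMost)
  then show "\<forall>k<CARD('t). x k = coef T k"
    by (auto simp: coef_def sg) (case_tac k, auto simp: sg)
next
  assume x: "\<forall>k<CARD('t). x k = coef T k"
  \<comment> \<open>Telescoping. At the full length the wrap rule turns this into: the total sum is
    \<open>- rel_sign T 0\<close>.\<close>
  have part: "2 * (\<Sum>k<m. x k) = rel_sign T m - rel_sign T 0" if "m \<le> CARD('t)" for m
    using that
  proof (induction m)
    case (Suc m)
    then have "x m = coef T m" using x by simp
    then show ?case using Suc by (simp add: coef_def)
  qed simp
  have "rel_sign (\<Sum>k<CARD('t). x k *\<^sub>R R k) (Suc m) = rel_sign T (Suc m)" if "m < CARD('t)" for m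
    using part[of "CARD('t)"] part[of "Suc m"] that
    by (simp add: combination_rel_sign rel_sign_wrap lessThan_Suc_atMost)
  then show "(\<Sum>k<CARD('t). x k *\<^sub>R R k) = T"
    by (simp add: vec_eq_iff_rel_sign)
qed

section \<open>Subset sums of the cycle and the minimal decomposition\<close>

text \<open>Folding the second half onto the first by antipodes: an antipodal pair contained in
  \<open>S\<close> cancels, just as if both were absent.\<close>

lemma sum_cycle_subset:
  assumes "S \<subseteq> cycle_verts R"
  shows "\<Sum>S = (\<Sum>k<CARD('t). (of_bool (R k \<in> S) - of_bool (R (k + CARD('t)) \<in> S)) *\<^sub>R R k)"
proof -
  let ?t = "CARD('t)"
  have "\<Sum>S = (\<Sum>v\<in>cycle_verts R. of_bool (v \<in> S) *\<^sub>R v)"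
    using assms by (intro sum.mono_neutral_cong_left) (auto simp: cycle_verts_def)
  also have "\<dots> = (\<Sum>k<?t + ?t. of_bool (R k \<in> S) *\<^sub>R R k)"
    unfolding cycle_verts_def using inj_R by (subst sum.reindex) (auto simp: mult_2)
  also have "\<dots> = (\<Sum>k<?t. of_bool (R k \<in> S) *\<^sub>R R k)
      + (\<Sum>k<?t. of_bool (R (k + ?t) \<in> S) *\<^sub>R R (k + ?t))"
    using sum.shift_bounds_nat_ivl[of "\<lambda>k. of_bool (R k \<in> S) *\<^sub>R R k" 0 ?t ?t]
    by (simp add: lessThan_atLeast0 sum.atLeastLessThan_concat[of 0 ?t "?t + ?t", symmetric])
  also have "\<dots> = (\<Sum>k<?t. (of_bool (R k \<in> S) - of_bool (R (k + ?t) \<in> S)) *\<^sub>R R k)"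
    by (simp add: R_antipode sum.distrib[symmetric] scaleR_diff_left)
  finally show ?thesis .
qed

lemma sum_cycle_subset_eq_iff:
  assumes "S \<subseteq> cycle_verts R"
  shows "\<Sum>S = T \<longleftrightarrow>
    (\<forall>k<CARD('t). of_bool (R k \<in> S) - of_bool (R (k + CARD('t)) \<in> S) = coef T k)"
  unfolding sum_cycle_subset[OF assms] combination_eq_iff ..

text \<open>Selects whichever of \<open>R k\<close> and \<open>- R k\<close> has to be summed. The
  second branch is meant for coefficient \<open>-1\<close>; coefficient \<open>0\<close> is excluded
  by applying it on \<open>sign_changes T\<close>.\<close>

definition basis_index :: "real ^ 't \<Rightarrow> nat \<Rightarrow> nat" where
  "basis_index T k = (if coef T k = 1 then k else k + CARD('t))"

lemma coef_cases:
  assumes "T \<in> hypercube_verts"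
  shows "coef T k = 0 \<or> coef T k = 1 \<or> coef T k = -1"
  using rel_sign_cases[OF assms, of k] rel_sign_cases[OF assms, of "Suc k"]
  by (auto simp: coef_def)

lemma sign_changes_coef: "sign_changes T = {k. k < CARD('t) \<and> coef T k \<noteq> 0}"
  by (auto simp: sign_changes_def coef_def)

lemma R_basis_index_in_iff:
  assumes k: "k < CARD('t)"
  shows "R k \<in> (R \<circ> basis_index T) ` sign_changes T \<longleftrightarrow> coef T k = 1"
    and "R (k + CARD('t)) \<in> (R \<circ> basis_index T) ` sign_changes T \<longleftrightarrow>
      coef T k \<noteq> 0 \<and> coef T k \<noteq> 1"
proof -
  have idx: "R j \<in> (R \<circ> basis_index T) ` sign_changes T \<longleftrightarrow> j \<in> basis_index T ` sign_changes T"
    if "j < 2 * CARD('t)" for j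
    unfolding image_comp[symmetric] using that
    by (intro inj_on_image_mem_iff[OF inj_R])
      (auto simp: basis_index_def sign_changes_def)
  show "R k \<in> (R \<circ> basis_index T) ` sign_changes T \<longleftrightarrow> coef T k = 1"
    using k by (subst idx) (auto simp: image_iff basis_index_def sign_changes_coef)
  show "R (k + CARD('t)) \<in> (R \<circ> basis_index T) ` sign_changes T \<longleftrightarrow>
      coef T k \<noteq> 0 \<and> coef T k \<noteq> 1"
    using k by (subst idx) (auto simp: image_iff basis_index_def sign_changes_coef)
qed

text \<open>The candidate is the least subset with sum \<open>T\<close>, not merely a minimal one,
  so existence and uniqueness of the minimal decomposition come together.\<close>

lemma Q_set_eq:
  assumes T: "T \<in> hypercube_verts"
  shows "Q_set T R = (R \<circ> basis_index T) ` sign_changes T"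
proof -
  let ?Q = "(R \<circ> basis_index T) ` sign_changes T"
  have sub: "?Q \<subseteq> cycle_verts R"
    by (auto simp: cycle_verts_def basis_index_def sign_changes_def)
  have sum: "\<Sum>?Q = T"
    unfolding sum_cycle_subset_eq_iff[OF sub]
  proof (intro allI impI)
    fix k assume "k < CARD('t)"
    then show "of_bool (R k \<in> ?Q) - of_bool (R (k + CARD('t)) \<in> ?Q) = coef T k"
      using coef_cases[OF T, of k] by (simp only: R_basis_index_in_iff) auto
  qed
  have least: "?Q \<subseteq> S" if S: "S \<subseteq> cycle_verts R" "\<Sum>S = T" for S
  proof
    fix v assume "v \<in> ?Q"
    then obtain k where k: "k < CARD('t)" "coef T k \<noteq> 0" "v = R (basis_index T k)"
      by (auto simp: sign_changes_coef)
    \<comment> \<open>A difference of two indicators equal to \<open>1\<close> or \<open>-1\<close>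
      forces the respective vertex into \<open>S\<close>.\<close>
    have "of_bool (R k \<in> S) - of_bool (R (k + CARD('t)) \<in> S) = coef T k"
      using S k(1) sum_cycle_subset_eq_iff by blast
    then show "v \<in> S"
      using coef_cases[OF T, of k] k
      by (auto simp: basis_index_def of_bool_def split: if_splits)
  qed
  show ?thesis
    unfolding Q_set_def
  proof (rule the_equality)
    have "\<Sum>S \<noteq> T" if "S \<subset> ?Q" for S
      using least[of S] that sub by blast
    then show "minimal_decomposition T R ?Q"
      unfolding minimal_decomposition_def using sub sum by blast
  next
    fix S assume S: "minimal_decomposition T R S"
    then have "?Q \<subseteq> S"
      unfolding minimal_decomposition_def by (intro least) blast+
    moreover have "\<not> ?Q \<subset> S"
      using S sum unfolding minimal_decomposition_def by blast
    ultimately show "S = ?Q" by blast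
  qed
qed

lemma card_Q_set:
  assumes "T \<in> hypercube_verts"
  shows "card (Q_set T R) = card (sign_changes T)"
proof -
  \<comment> \<open>\<open>k\<close> is recovered from its image by reduction modulo the
    dimension.\<close>
  have "inj_on (basis_index T) (sign_changes T)"
    by (auto simp: inj_on_def basis_index_def sign_changes_def split: if_splits)
  moreover have "inj_on R (basis_index T ` sign_changes T)"
    by (rule inj_on_subset[OF inj_R]) (auto simp: basis_index_def sign_changes_def)
  ultimately have "inj_on (R \<circ> basis_index T) (sign_changes T)"
    by (rule comp_inj_on)
  then show ?thesis
    unfolding Q_set_eq[OF assms] by (rule card_image)
qed

section \<open>Counting vertices by their sign changes\<close>

lemma card_Int_lessThan_Suc:
  "card (A \<inter> {..<Suc m}) = card (A \<inter> {..<m}) + of_bool (m \<in> A)"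
proof -
  have "A \<inter> {..<Suc m} = (if m \<in> A then insert m (A \<inter> {..<m}) else A \<inter> {..<m})"
    by (auto simp: less_Suc_eq)
  then show ?thesis by simp
qed

lemma rel_sign_eq_power:
  assumes T: "T \<in> hypercube_verts" and "m \<le> CARD('t)"
  shows "rel_sign T m = rel_sign T 0 * (-1) ^ card (sign_changes T \<inter> {..<m})"
  using assms(2)
proof (induction m)
  case (Suc m)
  have "rel_sign T (Suc m) = rel_sign T m * (-1) ^ of_bool (m \<in> sign_changes T)"
    using Suc.prems rel_sign_cases[OF T, of m] rel_sign_cases[OF T, of "Suc m"]
    by (auto simp: sign_changes_def)
  then show ?case
    using Suc by (simp add: card_Int_lessThan_Suc power_add)
qed simp

text \<open>Oddness makes the twist consistent: after all changes the last sign is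
  \<open>- e\<close>, so its negation at index \<open>0\<close> is again \<open>e\<close>.\<close>

lemma rel_sign_signed_vertex:
  assumes "A \<subseteq> {..<CARD('t)}" "odd (card A)" "m \<le> CARD('t)"
  shows "rel_sign (signed_vertex (A, e)) m = e * (-1) ^ card (A \<inter> {..<m})"
proof -
  have Suc: "rel_sign (signed_vertex (A, e)) (Suc m) = e * (-1) ^ card (A \<inter> {..<Suc m})"
    if "m < CARD('t)" for m
    using that bij_d
    by (simp add: rel_sign_Suc signed_vertex_def bij_betw_def the_inv_into_f_f lessThan_Suc_atMost)
  obtain n where n: "CARD('t) = Suc n"
    using card_pos by (cases "CARD('t)") auto
  have "rel_sign (signed_vertex (A, e)) CARD('t) = - e"
    using Suc[of n] assms by (simp add: n Int_absorb2)
  then have "rel_sign (signed_vertex (A, e)) 0 = e"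
    by (simp add: rel_sign_wrap)
  then show ?thesis
    using assms(3) Suc by (cases m) auto
qed

lemma signed_vertex_in_hypercube:
  assumes "e \<in> {1, -1}"
  shows "signed_vertex (A, e) \<in> hypercube_verts"
proof -
  have "R 0 $ i * (e * (-1) ^ n) \<in> {1, -1}" for i n
    using assms R0 by (cases "even n") (auto elim!: hypercube_verts_cases[of _ i])
  then show ?thesis
    unfolding signed_vertex_def hypercube_verts_def Let_def by simp
qed

text \<open>The binomial coefficient counts the sets of change positions, and the factor
  \<open>2\<close> is the free choice of the sign at index \<open>0\<close>.\<close>

lemma card_sign_changes_eq:
  assumes j: "odd j"
  shows "card {T \<in> hypercube_verts. card (sign_changes T) = j} = 2 * (CARD('t) choose j)"
proof -
  let ?P = "{A. A \<subseteq> {..<CARD('t)} \<and> card A = j} \<times> {1, -1 :: real}"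
  let ?V = "{T \<in> hypercube_verts. card (sign_changes T) = j}"
  have changes: "sign_changes (signed_vertex (A, e)) = A"
    if A: "A \<subseteq> {..<CARD('t)}" "card A = j" and e: "e \<in> {1, -1}" for A e
  proof -
    have "k \<in> sign_changes (signed_vertex (A, e)) \<longleftrightarrow> k \<in> A" if k: "k < CARD('t)" for k
      using A e j k
      by (auto simp: sign_changes_def rel_sign_signed_vertex card_Int_lessThan_Suc)
    then show ?thesis
      using A by (auto simp: sign_changes_def)
  qed
  have "bij_betw signed_vertex ?P ?V"
  proof (rule bij_betw_byWitness[where f' = "\<lambda>T. (sign_changes T, rel_sign T 0)"])
    show "\<forall>p\<in>?P. (sign_changes (signed_vertex p), rel_sign (signed_vertex p) 0) = p"
      using changes j by (auto simp: rel_sign_signed_vertex)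
    show "\<forall>T\<in>?V. signed_vertex (sign_changes T, rel_sign T 0) = T"
    proof
      fix T assume T: "T \<in> ?V"
      have "sign_changes T \<subseteq> {..<CARD('t)}"
        by (auto simp: sign_changes_def)
      \<comment> \<open>Both sides have the same relative signs: the initial sign times the parity
        of the changes passed so far.\<close>
      then show "signed_vertex (sign_changes T, rel_sign T 0) = T"
        using T j
        by (simp add: vec_eq_iff_rel_sign rel_sign_signed_vertex rel_sign_eq_power[of T "Suc _"] Suc_le_eq)
    qed
    show "signed_vertex ` ?P \<subseteq> ?V"
      using changes signed_vertex_in_hypercube by auto
    show "(\<lambda>T. (sign_changes T, rel_sign T 0)) ` ?V \<subseteq> ?P"
      using rel_sign_cases by (fastforce simp: sign_changes_def)
  qed
  then have "card ?V = card ?P"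
    by (simp add: bij_betw_same_card)
  also have "\<dots> = 2 * (CARD('t) choose j)"
    by (simp add: card_cartesian_product n_subsets)
  finally show ?thesis .
qed

lemma c_num_eq:
  assumes "odd j"
  shows "c_num R j = 2 * (CARD('t) choose j)"
proof -
  have "{T \<in> hypercube_verts. card (Q_set T R) = j} =
      {T \<in> hypercube_verts. card (sign_changes T) = j}"
    by (auto simp: card_Q_set)
  then show ?thesis
    unfolding c_num_def by (simp add: card_sign_changes_eq assms)
qed

end

theorem theorem4p2:
  fixes R :: "nat \<Rightarrow> real ^ 't"
  assumes "CARD('t) \<ge> 2"
    and "symmetric_cycle R"
  shows "(\<forall>j. odd j \<and> 1 \<le> j \<and> j \<le> CARD('t) \<longrightarrow> c_num R j = 2 * (CARD('t) choose j))
    \<and> gamma_poly R =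
        smult 2 (\<Sum>j | 1 \<le> j \<and> j \<le> CARD('t) \<and> odd j. monom (int (CARD('t) choose j)) j)"
proof -
  obtain d where "flip_order R d"
    using symmetric_cycle_flip_order[OF assms(2)] .
  then have c: "c_num R j = 2 * (CARD('t) choose j)" if "odd j" for j
    using flip_order.c_num_eq that by blast
  then have "gamma_poly R =
      smult 2 (\<Sum>j | 1 \<le> j \<and> j \<le> CARD('t) \<and> odd j. monom (int (CARD('t) choose j)) j)"
    unfolding gamma_poly_def
    \<comment> \<open>\<open>smult 2\<close> is additive, so it moves inside the sum and the
      comparison becomes termwise.\<close>
    by (subst sum_comp_morphism[of "smult 2", symmetric])
      (auto simp: smult_add_right smult_monom intro!: sum.cong)
  with c show ?thesis by blast
qed

end
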